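(* Let $S$ be a numerical semigroup that is not irreducible, with $\mathrm{PF}(S)=\{g_1<\dots<g_k\}$, $k\ge 2$. Then there exists a chain of numerical semigroups $$S=S_0\subset S_1=S\cup\{x_1\}\subset\dots\subset S_l=S\cup\{x_1,\dots,x_l\}$$ such that (1) $S_l$ is irreducible; (2) $x_i=\max(S_l\setminus S_{i-1})$ for all $i\in\{1,\dots,l\}$; (3) $\{x\in\mathrm{PF}(S): g_k/2<x<g_k\}\subset S_l$; (4) for every $i\in\{1,\dots,l\}$, $x_i$ is a minimal generator of $S_i$ such that $g_j-x_i\in S_i$ for some $j\in\{1,\dots,k\}$; (5) for every $i\in\{1,\dots,l\}$ and every $f\in\mathrm{PF}(S_i)$ with $f\ne g_k$, there exists $j\in\{1,\dots,k-1\}$ such that $g_j-f\in S_i$.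
   Context: A numerical semigroup is a cofinite submonoid $S$ of $(\mathbb N,+)$, where $\mathbb N$ is the set of nonnegative integers. The set of pseudo-Frobenius numbers is $\mathrm{PF}(S)=\{x\in\mathbb Z\setminus S: x+s\in S\text{ for all }s\in S\setminus\{0\}\}$. A numerical semigroup is irreducible if it cannot be expressed as the intersection of two numerical semigroups properly containing it. A minimal generator of a numerical semigroup is an element of its unique minimal generating system (a nonzero element that is not the sum of two nonzero elements of the semigroup). *)

theory Defs
  imports Complex_Main
begin

definition numerical_semigroup :: "nat set \<Rightarrow> bool" where
  "numerical_semigroup S \<longleftrightarrow>
     0 \<in> S \<and> (\<forall>a\<in>S. \<forall>b\<in>S. a + b \<in> S) \<and> finite (- S)"

(* Pseudo-Frobenius numbers are integers, possibly negative: PF(UNIV) = {-1}. *)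
definition PF :: "nat set \<Rightarrow> int set" where
  "PF S = {x. x \<notin> int ` S \<and> (\<forall>s\<in>S - {0}. x + int s \<in> int ` S)}"

definition irreducible_ns :: "nat set \<Rightarrow> bool" where
  "irreducible_ns S \<longleftrightarrow> numerical_semigroup S \<and>
     \<not> (\<exists>T U. numerical_semigroup T \<and> numerical_semigroup U \<and>
              S \<subset> T \<and> S \<subset> U \<and> S = T \<inter> U)"

definition minimal_generator :: "nat set \<Rightarrow> nat \<Rightarrow> bool" where
  "minimal_generator S x \<longleftrightarrow>
     x \<in> S \<and> x \<noteq> 0 \<and> \<not> (\<exists>a\<in>S - {0}. \<exists>b\<in>S - {0}. x = a + b)"

end

theory Submission
  imports Defs "HOL-Library.Infinite_Set"
begin

text \<open>
  Let \<open>F\<close> be the Frobenius number of \<open>S\<close>, which is the largest pseudo-Frobenius number \<open>g k\<close>.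
  The chain climbs towards one particular irreducible oversemigroup, obtained by adjoining the set
  \<open>D\<close> of all gaps \<open>x\<close> in the upper half \<open>F/2 < x < F\<close> whose mirror image \<open>F - x\<close> is a gap too.
  Two facts make this choice work. First, \<open>D + D\<close> lies beyond \<open>F\<close>, and
  adding a nonzero element of \<open>S\<close> to an element of \<open>D\<close> gives an element
  of \<open>S\<close> or a larger element of \<open>D\<close>; hence adjoining any upward closed
  part of \<open>D\<close> already gives a numerical semigroup
  (\<open>numerical_semigroup_Un_upper_gaps\<close>), and \<open>D\<close> can be adjoined one
  element at a time in decreasing order. Since each member of the chain is a semigroup, the
  element adjoined next is not a sum of two nonzero earlier ones, so it is a minimal generator
  (\<open>minimal_generator_insert\<close>). Second, in \<open>S \<union> D\<close> every gap
  other than \<open>F/2\<close> has its mirror image in the semigroup, which forces irreducibility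
  (\<open>irreducible_nsI_mirror\<close>). The set \<open>D\<close> contains the pseudo-Frobenius
  numbers strictly between \<open>F/2\<close> and \<open>F\<close>, because \<open>f + (F - f) =
  F\<close> is a gap.

  The conditions relating the chain to \<open>PF S\<close> come from the fact that every integer outside \<open>S\<close>
  lies below some pseudo-Frobenius number in the order \<open>y - x \<in> S\<close> (\<open>ex_PF_above\<close>). For a
  pseudo-Frobenius number \<open>f \<noteq> F\<close> of a member of the chain, that bound cannot be \<open>F\<close> itself:
  otherwise \<open>F = f + (F - f)\<close> would lie in this member, whereas no member contains \<open>F\<close>.
\<close>

section \<open>Pseudo-Frobenius numbers\<close>

text \<open>
  Above \<open>x\<close>, in the order \<open>y - x \<in> S\<close>, only finitely many integers lie outside \<open>S\<close>, as all of
  them are at most \<open>F\<close>. The largest of them is pseudo-Frobenius, since adding a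
  nonzero element of \<open>S\<close> to it gives an integer that is larger and still above \<open>x\<close>.
\<close>
lemma ex_PF_above:
  fixes x :: int and F :: nat
  assumes S: "numerical_semigroup S" and above: "\<And>n. F < n \<Longrightarrow> n \<in> S" and x: "x \<notin> int ` S"
  shows "\<exists>p\<in>PF S. p - x \<in> int ` S"
proof -
  define A where "A = {y. y \<notin> int ` S \<and> y - x \<in> int ` S}"
  have bound: "y \<le> int F" if "y \<notin> int ` S" for y
  proof (rule ccontr)
    assume "\<not> y \<le> int F"
    then have "y = int (nat y)" "F < nat y" by auto
    with above that show False by blast
  qed
  have "A \<subseteq> {x..int F}"
    using bound by (auto simp: A_def)
  then have fin: "finite A" by (rule finite_subset) simp
  have "x \<in> A"
    using x S by (auto simp: A_def numerical_semigroup_def image_iff intro: bexI[of _ 0])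
  then have p: "Max A \<in> A" using fin by (intro Max_in) auto
  have "Max A + int s \<in> int ` S" if s: "s \<in> S - {0}" for s
  proof (rule ccontr)
    assume out: "Max A + int s \<notin> int ` S"
    obtain t where t: "t \<in> S" "Max A - x = int t" using p by (auto simp: A_def)
    have "Max A + int s - x = int (t + s)" using t by simp
    moreover have "t + s \<in> S" using t(1) s S by (simp add: numerical_semigroup_def)
    ultimately have "Max A + int s - x \<in> int ` S" by (rule image_eqI)
    then have "Max A + int s \<in> A" using out unfolding A_def by blast
    then have "Max A + int s \<le> Max A" by (rule Max_ge[OF fin])
    then show False using s by simp
  qed
  then have "Max A \<in> PF S" using p by (auto simp: PF_def A_def)
  then show ?thesis using p by (auto simp: A_def)
qed

lemma Frobenius_is_greatest_PF:
  fixes F :: nat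
  assumes "F \<notin> S" and above: "\<And>n. F < n \<Longrightarrow> n \<in> S"
  shows "int F \<in> PF S" and "\<And>y. y \<in> PF S \<Longrightarrow> y \<le> int F"
proof -
  have "int F + int s \<in> int ` S" if "s \<in> S - {0}" for s
    using above[of "F + s"] that by (auto simp: image_iff intro!: bexI[of _ "F + s"])
  then show "int F \<in> PF S" using \<open>F \<notin> S\<close> by (auto simp: PF_def)
next
  fix y assume "y \<in> PF S"
  then have "y \<notin> int ` S" by (simp add: PF_def)
  show "y \<le> int F"
  proof (rule ccontr)
    assume "\<not> y \<le> int F"
    then have "y = int (nat y)" "F < nat y" by auto
    with above \<open>y \<notin> int ` S\<close> show False by blast
  qed
qed

text \<open>
  A pseudo-Frobenius number other than \<open>z\<close> cannot be carried to a gap \<open>z\<close> by adding an element of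
  the semigroup.
\<close>
lemma PF_diff_notin:
  assumes "f \<in> PF T" "z \<notin> int ` T" "f \<noteq> z"
  shows "z - f \<notin> int ` T"
proof
  assume "z - f \<in> int ` T"
  then obtain s where "s \<in> T" "z - f = int s" by auto
  moreover from this have "s \<noteq> 0" using \<open>f \<noteq> z\<close> by auto
  ultimately have "f + int s \<in> int ` T" using \<open>f \<in> PF T\<close> by (auto simp: PF_def)
  then show False using \<open>z - f = int s\<close> \<open>z \<notin> int ` T\<close> by (simp add: algebra_simps)
qed

section \<open>Irreducibility and adjoining upper gaps\<close>

text \<open>
  Of two semigroups intersecting in \<open>T\<close>, one avoids \<open>F\<close>. A new element \<open>a\<close> of that one would
  produce \<open>F\<close>, either as \<open>a + a\<close> or as \<open>a + (F - a)\<close>.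
\<close>
lemma irreducible_nsI_mirror:
  fixes F :: nat
  assumes T: "numerical_semigroup T" and "F \<notin> T"
    and mirror: "\<And>y. y \<notin> T \<Longrightarrow> 2 * y = F \<or> y \<le> F \<and> F - y \<in> T"
  shows "irreducible_ns T"
proof -
  have F_mem: "F \<in> A" if A: "numerical_semigroup A" "T \<subset> A" for A
  proof -
    obtain a where a: "a \<in> A" "a \<notin> T" using A by blast
    have add: "b + c \<in> A" if "b \<in> A" "c \<in> A" for b c
      using A that by (auto simp: numerical_semigroup_def)
    from mirror[OF a(2)] show "F \<in> A"
    proof
      assume "2 * a = F"
      then show ?thesis using add[OF a(1) a(1)] by (simp add: mult_2)
    next
      assume "a \<le> F \<and> F - a \<in> T"
      then show ?thesis using add[OF a(1), of "F - a"] A by auto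
    qed
  qed
  have "T \<noteq> A \<inter> B" if "numerical_semigroup A" "numerical_semigroup B" "T \<subset> A" "T \<subset> B" for A B
    using F_mem[of A] F_mem[of B] that \<open>F \<notin> T\<close> by auto
  then show ?thesis using T unfolding irreducible_ns_def by auto
qed

definition upper_gaps :: "nat set \<Rightarrow> nat \<Rightarrow> nat set" where
  "upper_gaps S F = {x. x \<notin> S \<and> F < 2 * x \<and> x < F \<and> F - x \<notin> S}"

text \<open>
  The only sums that need care are \<open>x + s\<close> with \<open>x\<close> an upper gap and \<open>s \<in> S\<close>. The mirror image
  \<open>F - x - s\<close> cannot lie in \<open>S\<close>, as adding \<open>s\<close> would put \<open>F - x\<close> into \<open>S\<close>; so a sum outside \<open>S\<close>
  is again an upper gap, and it is at least \<open>x\<close>.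
\<close>
lemma numerical_semigroup_Un_upper_gaps:
  fixes F :: nat
  assumes S: "numerical_semigroup S" and above: "\<And>n. F < n \<Longrightarrow> n \<in> S"
    and E: "E \<subseteq> upper_gaps S F"
    and up: "\<And>d e. e \<in> E \<Longrightarrow> d \<in> upper_gaps S F \<Longrightarrow> e \<le> d \<Longrightarrow> d \<in> E"
  shows "numerical_semigroup (S \<union> E)"
proof -
  have Sadd: "a + b \<in> S" if "a \<in> S" "b \<in> S" for a b
    using S that by (auto simp: numerical_semigroup_def)
  have shift: "e + s \<in> S \<union> E" if e: "e \<in> E" and s: "s \<in> S" for e s
  proof (cases "e + s \<in> S")
    case False
    have e': "e \<notin> S" "F < 2 * e" "e < F" "F - e \<notin> S" using e E by (auto simp: upper_gaps_def)
    have "e + s \<le> F" using False above by (meson not_le)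
    moreover have "e + s \<noteq> F" using e' s by auto
    ultimately have lt: "e + s < F" by simp
    have "F - (e + s) \<notin> S"
    proof
      assume "F - (e + s) \<in> S"
      then have "F - (e + s) + s \<in> S" using s by (rule Sadd)
      then show False using e' lt by simp
    qed
    then have "e + s \<in> upper_gaps S F" using False e' lt by (simp add: upper_gaps_def)
    then show ?thesis using up[OF e] by simp
  qed simp
  have sum: "d + e \<in> S \<union> E" if "d \<in> E" "e \<in> E" for d e
  proof -
    have "F < 2 * d" "F < 2 * e" using that E by (auto simp: upper_gaps_def)
    then show ?thesis using above[of "d + e"] by simp
  qed
  have "a + b \<in> S \<union> E" if "a \<in> S \<union> E" "b \<in> S \<union> E" for a b
    using that Sadd[of a b] sum[of a b] shift[of a b] shift[of b a] by (auto simp: add.commute[of b a])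
  moreover have "finite (- (S \<union> E))"
    using S by (auto simp: numerical_semigroup_def intro: finite_subset[of _ "- S"])
  ultimately show ?thesis using S by (simp add: numerical_semigroup_def)
qed

lemma irreducible_Un_upper_gaps:
  fixes F :: nat
  assumes S: "numerical_semigroup S" and "F \<notin> S" and above: "\<And>n. F < n \<Longrightarrow> n \<in> S"
  shows "irreducible_ns (S \<union> upper_gaps S F)"
proof (rule irreducible_nsI_mirror)
  show "numerical_semigroup (S \<union> upper_gaps S F)"
    using numerical_semigroup_Un_upper_gaps[OF S above] by blast
  show "F \<notin> S \<union> upper_gaps S F" using \<open>F \<notin> S\<close> by (simp add: upper_gaps_def)
next
  fix y assume y: "y \<notin> S \<union> upper_gaps S F"
  have zero: "0 \<in> S" using S by (simp add: numerical_semigroup_def)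
  have "y \<le> F" using y above by (meson UnI1 not_le)
  consider "2 * y = F" | "F < 2 * y" | "2 * y < F" by linarith
  then show "2 * y = F \<or> y \<le> F \<and> F - y \<in> S \<union> upper_gaps S F"
  proof cases
    case 2
    then show ?thesis using y zero \<open>y \<le> F\<close> by (cases "y = F") (auto simp: upper_gaps_def)
  next
    case 3
    (* Here F - y is in the upper half and its mirror image y is a gap, so F - y is in S or an
       upper gap; it is below F because 0 is in S and hence y is positive. *)
    have "y \<noteq> 0" using y zero by (metis UnI1)
    then show ?thesis using 3 y by (auto simp: upper_gaps_def)
  qed simp
qed

lemma PF_in_upper_gaps:
  fixes F :: nat
  assumes "F \<notin> S" and y: "y \<in> PF S" and half: "int F < 2 * y" "y < int F"
  shows "y \<in> int ` upper_gaps S F"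
proof -
  obtain n where n: "y = int n" using half by (cases y) auto
  have "int F - y \<notin> int ` S"
    using \<open>F \<notin> S\<close> half by (intro PF_diff_notin[OF y]) auto
  moreover have "int F - y = int (F - n)" using n half by simp
  ultimately have "F - n \<notin> S" by (metis imageI)
  moreover have "n \<notin> S" using y n by (auto simp: PF_def)
  ultimately have "n \<in> upper_gaps S F" using n half by (simp add: upper_gaps_def)
  then show ?thesis using n by simp
qed

section \<open>The chain\<close>

text \<open>
  If removing \<open>x\<close> leaves a semigroup, then a decomposition of \<open>x\<close> into nonzero summands, both of
  which differ from \<open>x\<close>, would take place in that semigroup.
\<close>
lemma minimal_generator_insert:
  assumes T: "numerical_semigroup T" and x: "x \<notin> T"
  shows "minimal_generator (insert x T) x"
proof -
  have "x \<noteq> 0" using T x by (cases x) (auto simp: numerical_semigroup_def)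
  moreover have False if "a \<in> insert x T - {0}" "b \<in> insert x T - {0}" "x = a + b" for a b
  proof -
    have "a \<in> T" "b \<in> T" using that by auto
    then have "a + b \<in> T" using T by (simp add: numerical_semigroup_def)
    then show False using x that by simp
  qed
  ultimately show ?thesis unfolding minimal_generator_def by blast
qed

lemma ex_decreasing_enumeration:
  fixes D :: "nat set"
  assumes "finite D"
  obtains x where "x ` {1..card D} = D" and "strict_antimono_on {1..card D} x"
proof -
  obtain h where h: "bij_betw h {..<card D} D" "strict_mono_on {..<card D} h"
    by (rule ex_bij_betw_strict_mono_card[OF assms])
  have "(\<lambda>i. card D - i) ` {1..card D} = {..<card D}"
  proof (intro equalityI subsetI)
    fix j assume "j \<in> {..<card D}"
    then show "j \<in> (\<lambda>i. card D - i) ` {1..card D}"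
      by (intro image_eqI[of _ _ "card D - j"]) auto
  qed auto
  then have "h ` (\<lambda>i. card D - i) ` {1..card D} = D"
    using bij_betw_imp_surj_on[OF h(1)] by (rule ssubst)
  then have "(\<lambda>i. h (card D - i)) ` {1..card D} = D" unfolding image_image .
  moreover have "strict_antimono_on {1..card D} (\<lambda>i. h (card D - i))"
    by (intro monotone_onI strict_mono_onD[OF h(2)]) auto
  ultimately show ?thesis by (rule that)
qed

theorem proposition44:
  fixes S :: "nat set" and g :: "nat \<Rightarrow> int" and k :: nat
  assumes "numerical_semigroup S"
    and "\<not> irreducible_ns S"
    and "k \<ge> 2"
    and "strict_mono_on {1..k} g"
    and "PF S = g ` {1..k}"
  shows "\<exists>(l::nat) (x :: nat \<Rightarrow> nat) (T :: nat \<Rightarrow> nat set).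
      l \<ge> 1 \<and> T 0 = S \<and>
      (\<forall>i\<in>{1..l}. T i = S \<union> x ` {1..i} \<and> numerical_semigroup (T i) \<and> T (i - 1) \<subset> T i) \<and>
      irreducible_ns (T l) \<and>
      (\<forall>i\<in>{1..l}. x i = Max (T l - T (i - 1))) \<and>
      {y \<in> PF S. real_of_int (g k) / 2 < real_of_int y \<and> y < g k} \<subseteq> int ` T l \<and>
      (\<forall>i\<in>{1..l}. minimal_generator (T i) (x i) \<and>
                   (\<exists>j\<in>{1..k}. g j - int (x i) \<in> int ` T i)) \<and>
      (\<forall>i\<in>{1..l}. \<forall>f\<in>PF (T i). f \<noteq> g k \<longrightarrow>
                   (\<exists>j\<in>{1..k - 1}. g j - f \<in> int ` T i))"
proof -
  note S = assms(1)
  have fin_gaps: "finite (- S)" using S by (simp add: numerical_semigroup_def)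
  have "S \<noteq> UNIV"
    using assms(1,2) by (auto simp: irreducible_ns_def)
  then have ne: "- S \<noteq> {}" by blast
  define F where "F = Max (- S)"
  have F: "F \<notin> S" using Max_in[OF fin_gaps ne] by (simp add: F_def)
  have above: "n \<in> S" if "F < n" for n
    using Max_ge[OF fin_gaps, of n] that by (auto simp: F_def not_le[symmetric])
  have gk: "g k = int F"
  proof (rule antisym)
    show "g k \<le> int F"
      using Frobenius_is_greatest_PF(2)[OF F above] assms(3,5) by auto
    obtain j where j: "j \<in> {1..k}" "int F = g j"
      using Frobenius_is_greatest_PF(1)[OF F above] assms(5) by auto
    then show "int F \<le> g k"
      using strict_mono_onD[OF assms(4), of j k] by (cases "j = k") auto
  qed

  define D where "D = upper_gaps S F"
  have finD: "finite D" by (rule finite_subset[of _ "{..F}"]) (auto simp: D_def upper_gaps_def)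
  have DS: "d \<notin> S" if "d \<in> D" for d using that by (simp add: D_def upper_gaps_def)
  have irr: "irreducible_ns (S \<union> D)"
    unfolding D_def by (rule irreducible_Un_upper_gaps[OF S F above])
  define l where "l = card D"
  obtain x where xD: "x ` {1..l} = D"
    and anti: "strict_antimono_on {1..l} x"
    unfolding l_def by (rule ex_decreasing_enumeration[OF finD])
  have dec: "x j < x i" if "1 \<le> i" "i < j" "j \<le> l" for i j
    using monotone_onD[OF anti, of i j] that by simp
  have "D \<noteq> {}" using irr assms(2) by auto
  then have l1: "l \<ge> 1" using finD by (simp add: l_def Suc_le_eq card_gt_0_iff)
  have part: "x ` {1..i} \<subseteq> D" if "i \<le> l" for i
    using image_mono[of "{1..i}" "{1..l}" x] that unfolding xD by simp
  define T where "T i = S \<union> x ` {1..i}" for i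
  have Tl: "T l = S \<union> D" using xD by (simp add: T_def del: One_nat_def)

  have semi: "numerical_semigroup (T i)" if "i \<le> l" for i
    unfolding T_def
  proof (rule numerical_semigroup_Un_upper_gaps[OF S above])
    show "x ` {1..i} \<subseteq> upper_gaps S F" using part[OF that] by (simp add: D_def)
    fix d e assume e: "e \<in> x ` {1..i}" and d: "d \<in> upper_gaps S F" and le: "e \<le> d"
    obtain a where a: "a \<in> {1..i}" "e = x a" using e by auto
    obtain b where b: "b \<in> {1..l}" "d = x b" using d xD unfolding D_def by blast
    have "b \<le> a" using dec[of a b] a b le by force
    then show "d \<in> x ` {1..i}" using a b by auto
  qed
  have step: "T i = insert (x i) (T (i - 1))" if "i \<in> {1..l}" for i
  proof -
    have "{1..i} = insert i {1..i - 1}" using that by auto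
    then show ?thesis by (auto simp: T_def)
  qed
  have xi: "x i \<in> D" if "i \<in> {1..l}" for i using xD that by blast
  have new: "x i \<notin> T (i - 1)" if i: "i \<in> {1..l}" for i
  proof
    assume "x i \<in> T (i - 1)"
    then obtain a where "a \<in> {1..i - 1}" "x i = x a" using DS xi[OF i] by (auto simp: T_def)
    then show False using dec[of a i] i by (cases i) auto
  qed
  have TF: "int F \<notin> int ` T i" if "i \<le> l" for i
  proof -
    have "T i \<subseteq> S \<union> D" using part[OF that] unfolding T_def by (rule Un_mono[OF subset_refl])
    then show ?thesis using F by (auto simp: D_def upper_gaps_def)
  qed
  have ST: "S \<subseteq> T i" for i by (simp add: T_def)

  have max: "x i = Max (T l - T (i - 1))" if i: "i \<in> {1..l}" for i
  proof (rule sym, rule Max_eqI)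
    show "finite (T l - T (i - 1))"
      by (rule finite_subset[OF _ finD]) (use Tl ST in auto)
    show "x i \<in> T l - T (i - 1)" using xi[OF i] new[OF i] Tl by simp
    fix y assume y: "y \<in> T l - T (i - 1)"
    then have "y \<in> D" using Tl ST by blast
    then obtain b where b: "b \<in> {1..l}" "y = x b" using xD by blast
    then have "\<not> b \<le> i - 1" using y by (auto simp: T_def)
    then have "b = i \<or> i < b" by arith
    then show "y \<le> x i" using dec[of i b] b i by auto
  qed
  have upper: "{y \<in> PF S. real_of_int (g k) / 2 < real_of_int y \<and> y < g k} \<subseteq> int ` T l"
  proof
    fix y assume "y \<in> {y \<in> PF S. real_of_int (g k) / 2 < real_of_int y \<and> y < g k}"
    then have y: "y \<in> PF S" "y < int F" "real F / 2 < real_of_int y" using gk by auto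
    then have "int F < 2 * y" by linarith
    then have "y \<in> int ` D" using PF_in_upper_gaps[OF F] y by (simp add: D_def)
    then show "y \<in> int ` T l" using Tl by auto
  qed
  have below: "\<exists>j\<in>{1..k}. g j - z \<in> int ` S" if "z \<notin> int ` S" for z
    using ex_PF_above[OF S above that] assms(5) by auto
  have gens: "minimal_generator (T i) (x i) \<and> (\<exists>j\<in>{1..k}. g j - int (x i) \<in> int ` T i)"
    if i: "i \<in> {1..l}" for i
  proof
    have "numerical_semigroup (T (i - 1))" using i by (intro semi) auto
    then show "minimal_generator (T i) (x i)"
      using minimal_generator_insert new[OF i] step[OF i] by simp
    have "int (x i) \<notin> int ` S" using DS[OF xi[OF i]] by auto
    then show "\<exists>j\<in>{1..k}. g j - int (x i) \<in> int ` T i"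
      using below ST by (meson image_mono subsetD)
  qed
  have pf: "\<exists>j\<in>{1..k - 1}. g j - f \<in> int ` T i"
    if i: "i \<in> {1..l}" and f: "f \<in> PF (T i)" "f \<noteq> g k" for i f
  proof -
    have "f \<notin> int ` S" using f ST by (auto simp: PF_def)
    then obtain j where j: "j \<in> {1..k}" "g j - f \<in> int ` T i"
      using below ST by (meson image_mono subsetD)
    have "g k - f \<notin> int ` T i"
      using PF_diff_notin[OF f(1) TF] f i gk by auto
    then have "j \<noteq> k" using j by auto
    then show ?thesis using j by (intro bexI[of _ j]) auto
  qed
  have chain: "T i = S \<union> x ` {1..i} \<and> numerical_semigroup (T i) \<and> T (i - 1) \<subset> T i"
    if i: "i \<in> {1..l}" for i
  proof (intro conjI)
    show "T i = S \<union> x ` {1..i}" by (rule T_def)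
    show "numerical_semigroup (T i)" using i by (intro semi) simp
    show "T (i - 1) \<subset> T i" using step[OF i] new[OF i] by blast
  qed
  have T0: "T 0 = S" by (simp add: T_def)
  have pf_all: "\<forall>i\<in>{1..l}. \<forall>f\<in>PF (T i). f \<noteq> g k \<longrightarrow>
      (\<exists>j\<in>{1..k - 1}. g j - f \<in> int ` T i)"
    by (intro ballI impI) (rule pf)
  show ?thesis
  proof (rule exI[of _ l], rule exI[of _ x], rule exI[of _ T], intro conjI)
    show "l \<ge> 1" by (rule l1)
    show "T 0 = S" by (rule T0)
    show "irreducible_ns (T l)" unfolding Tl by (rule irr)
  qed (rule ballI[OF chain] ballI[OF max] upper ballI[OF gens] pf_all; assumption)+
qed

end
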